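(* Let $n\ge1$. The Lie algebra $\mathfrak{iso}_{\tilde G}$ of Killing vector fields of the metric $\tilde G$ on $\tilde P=\mathbb{R}^{2n+2}$ is isomorphic to $\mathfrak{sl}(n+2,\mathbb{R})$ and is, as a vector space, the linear (direct) sum $$\mathfrak{iso}_{\tilde G}=\mathfrak q\oplus\mathfrak d\oplus\mathfrak x$$ of the following Lie subalgebras (indices run over $0,\dots,n$): 1) $\mathfrak q=\langle Q^i_j=x^i\partial_{x^j}-p_j\partial_{p_i}\rangle$, with commutator relations $[Q^i_j,Q^p_k]=\delta^p_jQ^i_k-\delta^i_kQ^p_j$, so that $\mathfrak q$ is isomorphic to $\mathfrak{gl}(n+1,\mathbb{R})$; 2) the abelian subalgebra $\mathfrak d=\langle D^i=\frac{x^i}{2}Q+\bigl(1-\frac12\sum_l x^lp_l\bigr)\partial_{p_i}\rangle$, where $Q=\sum_iQ^i_i=\sum_i(x^i\partial_{x^i}-p_i\partial_{p_i})$ is the generator of the hyperbolic rotations $(p,x)\mapsto(e^{-t}p,e^{t}x)$; 3) the abelian subalgebra $\mathfrak x=\langle X_s=\partial_{x^s}\rangle$. The generators $Q^i_j,X_s,D^s$ satisfy the commutator relations $$[Q^i_j,X_s]=-\delta^i_sX_j,\qquad[Q^i_j,D^s]=\delta^s_jD^i,\qquad[X_s,D^i]=\tfrac12Q^i_s+\tfrac12\delta^i_sQ.$$ The vector fields $Q^i_j,X_k,D^s$ are Hamiltonian, with Hamiltonian functions $$H_{Q^i_j}=-x^ip_j,\qquad H_{X_k}=-p_k,\qquad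 H_{D^s}=x^s\Bigl(1-\tfrac12\sum_lx^lp_l\Bigr).$$
   Context: $\tilde P=\mathbb{R}^{2n+2}$ has coordinates $(p_0,\dots,p_n;x^0,\dots,x^n)$, the 1-form $\tilde\theta=\sum_{i=0}^np_i\,dx^i$, and the symplectic form $\omega=d\tilde\theta=\sum_{i=0}^ndp_i\wedge dx^i$. The pseudo-Riemannian metric $\tilde G$, of signature $(n+1,n+1)$, is given in the coordinates $(p,x)$ by the matrix $$\tilde G=\begin{pmatrix}0_{(n+1)\times(n+1)} & I_{n+1} \\ I_{n+1} & (p_ip_j)\end{pmatrix},$$ i.e. $\tilde G=\sum_{i=0}^n(dp_i\otimes dx^i+dx^i\otimes dp_i)+\tilde\theta\otimes\tilde\theta$. A vector field $X$ is Killing if $\mathcal{L}_X\tilde G=0$. Angle brackets denote real linear span. The Hamiltonian function $H_X$ of $X$ satisfies $\iota_X\omega=dH_X$. *)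

theory Defs
  imports "HOL-Analysis.Analysis" "HOL-Library.Function_Algebras"
begin

section \<open>Real Lie algebras\<close>

text \<open>A Lie algebra on a carrier \<open>L\<close> inside an ambient real vector space: the bracket is a total
  function on the ambient type, but the axioms are required only on \<open>L\<close>.\<close>

locale real_lie_algebra = vector_space sc
  for sc :: "real \<Rightarrow> 'b::ab_group_add \<Rightarrow> 'b" +
  fixes br :: "'b \<Rightarrow> 'b \<Rightarrow> 'b" and L :: "'b set"
  assumes subspace_carrier: "subspace L"
    and br_closed: "\<lbrakk>x \<in> L; y \<in> L\<rbrakk> \<Longrightarrow> br x y \<in> L"
    and br_add_left: "\<lbrakk>x \<in> L; y \<in> L; z \<in> L\<rbrakk> \<Longrightarrow> br (x + y) z = br x z + br y z"
    and br_add_right: "\<lbrakk>x \<in> L; y \<in> L; z \<in> L\<rbrakk> \<Longrightarrow> br x (y + z) = br x y + br x z"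
    and br_scale_left: "\<lbrakk>x \<in> L; y \<in> L\<rbrakk> \<Longrightarrow> br (sc c x) y = sc c (br x y)"
    and br_scale_right: "\<lbrakk>x \<in> L; y \<in> L\<rbrakk> \<Longrightarrow> br x (sc c y) = sc c (br x y)"
    and br_self: "x \<in> L \<Longrightarrow> br x x = 0"
    and jacobi: "\<lbrakk>x \<in> L; y \<in> L; z \<in> L\<rbrakk> \<Longrightarrow> br x (br y z) + br y (br z x) + br z (br x y) = 0"

definition lie_subalgebra ::
  "(real \<Rightarrow> 'b::ab_group_add \<Rightarrow> 'b) \<Rightarrow> ('b \<Rightarrow> 'b \<Rightarrow> 'b) \<Rightarrow> 'b set \<Rightarrow> 'b set \<Rightarrow> bool" where
  "lie_subalgebra sc br M L \<longleftrightarrow>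
     M \<subseteq> L \<and> module.subspace sc M \<and> (\<forall>x\<in>M. \<forall>y\<in>M. br x y \<in> M)"

definition lie_abelian :: "('b::zero \<Rightarrow> 'b \<Rightarrow> 'b) \<Rightarrow> 'b set \<Rightarrow> bool" where
  "lie_abelian br M \<longleftrightarrow> (\<forall>x\<in>M. \<forall>y\<in>M. br x y = 0)"

definition lie_isomorphic ::
  "(real \<Rightarrow> 'b::ab_group_add \<Rightarrow> 'b) \<Rightarrow> ('b \<Rightarrow> 'b \<Rightarrow> 'b) \<Rightarrow> 'b set \<Rightarrow>
   (real \<Rightarrow> 'c::ab_group_add \<Rightarrow> 'c) \<Rightarrow> ('c \<Rightarrow> 'c \<Rightarrow> 'c) \<Rightarrow> 'c set \<Rightarrow> bool" where
  "lie_isomorphic sc br L sc' br' L' \<longleftrightarrow>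
     (\<exists>\<phi>. bij_betw \<phi> L L' \<and>
          (\<forall>x\<in>L. \<forall>y\<in>L. \<phi> (x + y) = \<phi> x + \<phi> y) \<and>
          (\<forall>c. \<forall>x\<in>L. \<phi> (sc c x) = sc' c (\<phi> x)) \<and>
          (\<forall>x\<in>L. \<forall>y\<in>L. \<phi> (br x y) = br' (\<phi> x) (\<phi> y)))"

definition direct_sum3 :: "'b::plus set \<Rightarrow> 'b set \<Rightarrow> 'b set \<Rightarrow> 'b set \<Rightarrow> bool" where
  "direct_sum3 V A B C \<longleftrightarrow> bij_betw (\<lambda>(a, b, c). a + b + c) (A \<times> B \<times> C) V"

definition commutator :: "real^'m^'m \<Rightarrow> real^'m^'m \<Rightarrow> real^'m^'m" where
  "commutator A B = A ** B - B ** A"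

definition gl :: "(real^'m^'m) set" where
  "gl = UNIV"

definition sl :: "(real^'m^'m) set" where
  "sl = {A. trace A = 0}"


section \<open>Vector fields and tensors on a vector space\<close>

primrec C_k :: "nat \<Rightarrow> ('a::real_normed_vector \<Rightarrow> 'b::real_normed_vector) \<Rightarrow> bool" where
  "C_k 0 f \<longleftrightarrow> continuous_on UNIV f"
| "C_k (Suc k) f \<longleftrightarrow>
     (\<forall>z. f differentiable (at z)) \<and> (\<forall>v. C_k k (\<lambda>z. frechet_derivative f (at z) v))"

definition smooth :: "('a::real_normed_vector \<Rightarrow> 'b::real_normed_vector) \<Rightarrow> bool" where
  "smooth f \<longleftrightarrow> (\<forall>k. C_k k f)"

type_synonym 'a vector_field = "'a \<Rightarrow> 'a"

text \<open>A covariant 2-tensor field, as a function of the base point and two tangent vectors.\<close>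

type_synonym 'a tensor2 = "'a \<Rightarrow> 'a \<Rightarrow> 'a \<Rightarrow> real"

definition vf_scale :: "real \<Rightarrow> ('a \<Rightarrow> 'b::real_vector) \<Rightarrow> 'a \<Rightarrow> 'b" where
  "vf_scale c X = (\<lambda>z. c *\<^sub>R X z)"

interpretation vf: vector_space "vf_scale :: real \<Rightarrow> ('a \<Rightarrow> 'b::real_vector) \<Rightarrow> 'a \<Rightarrow> 'b"
  by unfold_locales (auto simp: vf_scale_def fun_eq_iff algebra_simps)

text \<open>The sign is the one for which \<open>[X, Y] f = X (Y f) - Y (X f)\<close> for functions \<open>f\<close>.\<close>

definition lie_bracket ::
  "'a::real_normed_vector vector_field \<Rightarrow> 'a vector_field \<Rightarrow> 'a vector_field" where
  "lie_bracket X Y =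
     (\<lambda>z. frechet_derivative Y (at z) (X z) - frechet_derivative X (at z) (Y z))"

text \<open>\<open>(L\<^sub>X T)(Y, Z) = X (T(Y, Z)) - T([X, Y], Z) - T(Y, [X, Z])\<close>\<close>

definition lie_derivative ::
  "'a::real_normed_vector vector_field \<Rightarrow> 'a tensor2 \<Rightarrow> 'a vector_field \<Rightarrow> 'a vector_field \<Rightarrow> 'a \<Rightarrow> real" where
  "lie_derivative X T Y Z =
     (\<lambda>z. frechet_derivative (\<lambda>u. T u (Y u) (Z u)) (at z) (X z)
          - T z (lie_bracket X Y z) (Z z) - T z (Y z) (lie_bracket X Z z))"

definition killing_fields :: "'a::real_normed_vector tensor2 \<Rightarrow> 'a vector_field set" where
  "killing_fields T =
     {X. smooth X \<and> (\<forall>Y Z. smooth Y \<longrightarrow> smooth Z \<longrightarrow> (\<forall>z. lie_derivative X T Y Z z = 0))}"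

definition hamiltonian_function ::
  "'a::real_normed_vector tensor2 \<Rightarrow> 'a vector_field \<Rightarrow> ('a \<Rightarrow> real) \<Rightarrow> bool" where
  "hamiltonian_function \<Omega> X H \<longleftrightarrow>
     smooth H \<and> (\<forall>z v. \<Omega> z (X z) v = frechet_derivative H (at z) v)"

definition generates_flow ::
  "'a::real_normed_vector vector_field \<Rightarrow> (real \<Rightarrow> 'a \<Rightarrow> 'a) \<Rightarrow> bool" where
  "generates_flow X \<Phi> \<longleftrightarrow>
     (\<forall>z. \<Phi> 0 z = z \<and> (\<forall>t. ((\<lambda>s. \<Phi> s z) has_vector_derivative X (\<Phi> t z)) (at t)))"


section \<open>The phase space and its geometry\<close>

text \<open>The coordinates are \<open>(p, x)\<close>; the finite index type \<open>'n\<close> stands for \<open>{0, \<dots>, n}\<close>.\<close>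

type_synonym 'n phase = "(real^'n) \<times> (real^'n)"

abbreviation p_coord :: "'n \<Rightarrow> 'n::finite phase \<Rightarrow> real" where
  "p_coord i z \<equiv> fst z $ i"

abbreviation x_coord :: "'n \<Rightarrow> 'n::finite phase \<Rightarrow> real" where
  "x_coord i z \<equiv> snd z $ i"

text \<open>As the coordinates are linear, \<open>dp\<^sub>i\<close> and \<open>dx\<^sup>i\<close> are \<open>p_coord i\<close> and \<open>x_coord i\<close> applied to
  tangent vectors.\<close>

definition theta :: "'n::finite phase \<Rightarrow> 'n phase \<Rightarrow> real" where
  "theta z v = (\<Sum>i\<in>UNIV. p_coord i z * x_coord i v)"

text \<open>\<open>omega = d theta\<close>, with \<open>(\<alpha> \<and> \<beta>)(v, w) = \<alpha>(v) \<beta>(w) - \<alpha>(w) \<beta>(v)\<close>.\<close>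

definition omega :: "'n::finite phase tensor2" where
  "omega z v w = (\<Sum>i\<in>UNIV. p_coord i v * x_coord i w - p_coord i w * x_coord i v)"

definition metric_G :: "'n::finite phase tensor2" where
  "metric_G z v w =
     (\<Sum>i\<in>UNIV. p_coord i v * x_coord i w + x_coord i v * p_coord i w) + theta z v * theta z w"

definition pd_p :: "'n::finite \<Rightarrow> 'n phase vector_field" where
  "pd_p i = (\<lambda>z. (axis i 1, 0))"

definition pd_x :: "'n::finite \<Rightarrow> 'n phase vector_field" where
  "pd_x i = (\<lambda>z. (0, axis i 1))"

definition iso_G :: "'n::finite phase vector_field set" where
  "iso_G = killing_fields metric_G"

text \<open>In \<open>Q_fld i j\<close> the first index is the upper one.\<close>

definition Q_fld :: "'n::finite \<Rightarrow> 'n \<Rightarrow> 'n phase vector_field" where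
  "Q_fld i j = (\<lambda>z. x_coord i z *\<^sub>R pd_x j z - p_coord j z *\<^sub>R pd_p i z)"

definition Q_tot :: "'n::finite phase vector_field" where
  "Q_tot = (\<Sum>i\<in>UNIV. Q_fld i i)"

definition D_fld :: "'n::finite \<Rightarrow> 'n phase vector_field" where
  "D_fld i = (\<lambda>z. (x_coord i z / 2) *\<^sub>R Q_tot z
              + (1 - 1 / 2 * (\<Sum>l\<in>UNIV. x_coord l z * p_coord l z)) *\<^sub>R pd_p i z)"

definition X_fld :: "'n::finite \<Rightarrow> 'n phase vector_field" where
  "X_fld s = pd_x s"

definition \<qq> :: "'n::finite phase vector_field set" where
  "\<qq> = vf.span {Q_fld i j | i j. True}"

definition \<dd> :: "'n::finite phase vector_field set" where
  "\<dd> = vf.span {D_fld i | i. True}"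

definition \<xx> :: "'n::finite phase vector_field set" where
  "\<xx> = vf.span {X_fld s | s. True}"

definition kron :: "'n \<Rightarrow> 'n \<Rightarrow> real" where
  "kron i j = (if i = j then 1 else 0)"

end

(* Let X = (a, b) be a Killing field. The dp dp part of the Killing equation says that b(., x) is an
   infinitesimal isometry of Euclidean space, hence b(p, x) = c(x) + W(x) p with W(x) skew.
   Integrating the mixed part along the rays t -> (t p, x) gives
   a(p, x) . v = h(x) . v - p . (Dc(x) v), and comparing the parts of the mixed equation that are even
   and odd in p forces W = 0. The dx dx part then makes h a Euclidean infinitesimal isometry and
   c quadratic along lines: c(x + v) = c(x) + Dc(x) v + (h(x) . v) v / 2. Comparing expansions at
   different base points shows that h is constant. Only first derivatives of X are ever used.

   So X is determined by (L, d, c) with b = c + L x + (d . x) x / 2, the restriction of a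
   projective vector field on RP^(n+1) to the affine chart R^(n+1); such fields are parametrised by
   trace-free matrices of size n + 2. *)
theory Submission
  imports Defs
begin

section \<open>Smooth functions\<close>

lemma C_k_SucD: "C_k (Suc k) f \<Longrightarrow> C_k k f"
proof (induction k arbitrary: f)
  case 0
  then show ?case
    by (simp add: continuous_on_eq_continuous_within differentiable_imp_continuous_within)
next
  case (Suc k)
  from Suc.prems show ?case
    unfolding C_k.simps(2)[of "Suc k"] C_k.simps(2)[of k f] using Suc.IH by blast
qed

lemma C_k_const: "C_k k (\<lambda>z. c)"
  by (induction k arbitrary: c) auto

lemma C_k_linear:
  assumes "bounded_linear h"
  shows "C_k k h"
proof (cases k)
  case 0
  then show ?thesis
    using assms by (simp add: linear_continuous_on)
next
  case (Suc m)
  have "frechet_derivative h (at z) = h" for z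
    using bounded_linear_imp_has_derivative[OF assms] by (metis frechet_derivative_at)
  then show ?thesis
    using Suc assms by (simp add: C_k_const bounded_linear_imp_differentiable)
qed

lemma C_k_add: "C_k k f \<Longrightarrow> C_k k g \<Longrightarrow> C_k k (\<lambda>z. f z + g z)"
proof (induction k arbitrary: f g)
  case 0
  then show ?case by (simp add: continuous_on_add)
next
  case (Suc k)
  then have d: "f differentiable at z" "g differentiable at z" for z by simp_all
  have "frechet_derivative (\<lambda>z. f z + g z) (at z)
      = (\<lambda>v. frechet_derivative f (at z) v + frechet_derivative g (at z) v)" for z
    using d by (intro frechet_derivative_at[symmetric] has_derivative_add)
      (simp_all add: frechet_derivative_works[THEN iffD1])
  then show ?case
    using Suc d by (simp add: fun_eq_iff)
qed

text \<open>The product rule leaves one factor undifferentiated in each of its two terms. That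
  factor has one order of smoothness to spare, so \<open>C_k_SucD\<close> lowers it before the
  induction hypothesis applies. Scalar multiples, inner products and real products are all
  instances.\<close>

lemma C_k_bilinear:
  assumes "bounded_bilinear m"
  shows "C_k k f \<Longrightarrow> C_k k g \<Longrightarrow> C_k k (\<lambda>z. m (f z) (g z))"
proof (induction k arbitrary: f g)
  case 0
  then show ?case by (simp add: bounded_bilinear.continuous_on[OF assms])
next
  case (Suc k)
  then have d: "f differentiable at z" "g differentiable at z" for z by simp_all
  have D: "((\<lambda>z. m (f z) (g z)) has_derivative
      (\<lambda>v. m (f z) (frechet_derivative g (at z) v) + m (frechet_derivative f (at z) v) (g z))) (at z)" for z
    using d by (intro bounded_bilinear.FDERIV[OF assms]) (simp_all add: frechet_derivative_works[THEN iffD1])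
  have "frechet_derivative (\<lambda>z. m (f z) (g z)) (at z)
      = (\<lambda>v. m (f z) (frechet_derivative g (at z) v) + m (frechet_derivative f (at z) v) (g z))" for z
    using D by (metis frechet_derivative_at)
  moreover have "(\<lambda>z. m (f z) (g z)) differentiable at z" for z
    using D by (auto simp: differentiable_def)
  moreover have "C_k k f" "C_k k g"
    using Suc.prems by (auto intro: C_k_SucD)
  ultimately show ?case
    using Suc by (auto intro!: C_k_add)
qed

named_theorems smooth_intros

lemma smooth_const [smooth_intros]: "smooth (\<lambda>z. c)"
  by (simp add: smooth_def C_k_const)

lemma smooth_linear: "bounded_linear h \<Longrightarrow> smooth h"
  by (simp add: smooth_def C_k_linear)

lemma smooth_add [smooth_intros]: "smooth f \<Longrightarrow> smooth g \<Longrightarrow> smooth (\<lambda>z. f z + g z)"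
  by (simp add: smooth_def C_k_add)

lemma smooth_bilinear: "bounded_bilinear m \<Longrightarrow> smooth f \<Longrightarrow> smooth g \<Longrightarrow> smooth (\<lambda>z. m (f z) (g z))"
  by (simp add: smooth_def C_k_bilinear)

lemmas smooth_scaleR [smooth_intros] = smooth_bilinear[OF bounded_bilinear_scaleR]
lemmas smooth_inner [smooth_intros] = smooth_bilinear[OF bounded_bilinear_inner]
lemmas smooth_mult [smooth_intros] = smooth_bilinear[OF bounded_bilinear_mult]

lemma smooth_bounded_linear_comp:
  assumes "bounded_linear h" "smooth f"
  shows "smooth (\<lambda>z. h (f z))"
proof -
  \<comment> \<open>Composition with \<open>h\<close> is read as a bilinear product whose first
    factor is the constant function 1, so no chain rule for \<open>C_k\<close> is involved.\<close>
  have "bounded_bilinear (\<lambda>(r::real) y. r *\<^sub>R h y)"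
    using bounded_bilinear.comp[OF bounded_bilinear_scaleR bounded_linear_ident assms(1)] by simp
  from smooth_bilinear[OF this smooth_const[of 1] assms(2)] show ?thesis by simp
qed

lemma smooth_minus [smooth_intros]: "smooth f \<Longrightarrow> smooth (\<lambda>z. - f z)"
  by (rule smooth_bounded_linear_comp[OF bounded_linear_minus[OF bounded_linear_ident]])

lemma smooth_diff [smooth_intros]: "smooth f \<Longrightarrow> smooth g \<Longrightarrow> smooth (\<lambda>z. f z - g z)"
  using smooth_add[OF _ smooth_minus, of f g] by simp

lemma smooth_Pair [smooth_intros]:
  assumes "smooth f" "smooth g"
  shows "smooth (\<lambda>z. (f z, g z))"
proof -
  have "smooth (\<lambda>z. (f z, 0) + (0, g z))"
    using assms by (intro smooth_add smooth_bounded_linear_comp[of "\<lambda>y. (y, 0)"]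
        smooth_bounded_linear_comp[of "\<lambda>y. (0, y)"])
      (auto intro!: bounded_linear_Pair bounded_linear_zero bounded_linear_ident)
  then show ?thesis by simp
qed

lemma smooth_fst [smooth_intros]: "smooth fst"
  and smooth_snd [smooth_intros]: "smooth snd"
  by (simp_all add: smooth_linear bounded_linear_fst bounded_linear_snd)

lemma smooth_vec_nth [smooth_intros]: "smooth f \<Longrightarrow> smooth (\<lambda>z. f z $ i)"
  by (rule smooth_bounded_linear_comp[OF bounded_linear_vec_nth])

lemma smooth_matrix_vector_mult [smooth_intros]:
  fixes A :: "real^'n^'m"
  shows "smooth f \<Longrightarrow> smooth (\<lambda>z. A *v f z)"
  by (rule smooth_bounded_linear_comp[OF matrix_vector_mul_bounded_linear])

lemma smooth_has_derivative:
  "smooth f \<Longrightarrow> (f has_derivative frechet_derivative f (at z)) (at z)"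
  unfolding smooth_def by (metis C_k.simps(2) frechet_derivative_works[THEN iffD1])

section \<open>Killing fields of the metric\<close>

lemma metric_G_inner:
  "metric_G z v w = fst v \<bullet> snd w + snd v \<bullet> fst w + (fst z \<bullet> snd v) * (fst z \<bullet> snd w)"
  by (simp add: metric_G_def theta_def inner_vec_def sum.distrib)

text \<open>The derivatives of \<open>Y\<close> and \<open>Z\<close> from the product rule cancel
  against those inside the two brackets, so the result depends on \<open>Y\<close> and
  \<open>Z\<close> only through their values at \<open>z\<close>. The first two summands come from
  differentiating \<open>theta\<close> along \<open>X\<close>: it is the only part of the metric
  that varies with the base point.\<close>

lemma lie_derivative_metric_G:
  assumes "\<And>z. (X has_derivative X' z) (at z)" and "smooth Y" and "smooth Z"
  shows "lie_derivative X metric_G Y Z z =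
    (fst (X z) \<bullet> snd (Y z)) * (fst z \<bullet> snd (Z z)) + (fst z \<bullet> snd (Y z)) * (fst (X z) \<bullet> snd (Z z))
    + metric_G z (X' z (Y z)) (Z z) + metric_G z (Y z) (X' z (Z z))"
proof -
  let ?Y = "frechet_derivative Y (at z)" and ?Z = "frechet_derivative Z (at z)"
  note D = smooth_has_derivative[OF assms(2), of z] smooth_has_derivative[OF assms(3), of z]
  have 1: "frechet_derivative (\<lambda>u. metric_G u (Y u) (Z u)) (at z) =
     (\<lambda>v. metric_G z (?Y v) (Z z) + metric_G z (Y z) (?Z v)
       + (fst v \<bullet> snd (Y z)) * (fst z \<bullet> snd (Z z)) + (fst z \<bullet> snd (Y z)) * (fst v \<bullet> snd (Z z)))"
    by (rule frechet_derivative_at[symmetric], unfold metric_G_inner)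
      (auto intro!: derivative_eq_intros D simp: algebra_simps)
  have "frechet_derivative X (at z) = X' z"
    using assms(1) by (metis frechet_derivative_at)
  then show ?thesis
    unfolding lie_derivative_def 1 lie_bracket_def
    by (simp add: metric_G_inner algebra_simps)
qed

section \<open>Derivatives along lines and infinitesimal isometries of Euclidean space\<close>

lemma has_real_derivative_along_line:
  assumes "(f has_derivative f') (at (z + t *\<^sub>R v))"
  shows "((\<lambda>t. f (z + t *\<^sub>R v) \<bullet> w) has_real_derivative f' v \<bullet> w) (at t)"
  unfolding has_field_derivative_def
  by (rule has_derivative_eq_rhs, rule derivative_eq_intros,
      rule has_derivative_compose[where f = "\<lambda>t. z + t *\<^sub>R v", OF _ assms], (rule derivative_eq_intros refl)+)
    (auto simp: fun_eq_iff linear_scale[OF has_derivative_linear[OF assms]])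

text \<open>Turns a formula for one component of \<open>f\<close> on a line into a component of its
  Frechet derivative. Most partial derivatives of an unknown Killing field are extracted this
  way.\<close>

lemma derivative_along_line_unique:
  assumes "(f has_derivative f') (at z)"
    and "\<And>t. f (z + t *\<^sub>R v) \<bullet> w = g t" and "(g has_real_derivative d) (at 0)"
  shows "f' v \<bullet> w = d"
proof -
  have "((\<lambda>t. f (z + t *\<^sub>R v) \<bullet> w) has_real_derivative f' v \<bullet> w) (at 0)"
    using assms(1) by (intro has_real_derivative_along_line) simp
  then show ?thesis
    using assms(2,3) DERIV_unique by (simp add: fun_eq_iff)
qed

text \<open>The conservation law of a Killing field along straight lines: the component of
  \<open>f\<close> in the direction of the line has derivative
  \<open>f' x v \<bullet> v = 0\<close>.\<close>

lemma euclidean_killing: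
  fixes f :: "'a::real_inner \<Rightarrow> 'a"
  assumes D: "\<And>x. (f has_derivative f' x) (at x)" and skew: "\<And>x v. f' x v \<bullet> v = 0"
  shows "(f y - f x) \<bullet> (y - x) = 0"
proof -
  have "((\<lambda>t. f (x + t *\<^sub>R (y - x)) \<bullet> (y - x)) has_real_derivative 0) (at t)" for t
    using has_real_derivative_along_line[of f "f' (x + t *\<^sub>R (y - x))" x t "y - x" "y - x", OF D]
    by (simp add: skew)
  from DERIV_isconst_all[OF allI[OF this], of 1 0] show ?thesis
    by (simp add: inner_diff_left)
qed

text \<open>Comparing \<open>x\<close> and \<open>y\<close> with 0 removes the diagonal terms of g =
  f - f 0; the pair x, y then leaves only the two cross terms.\<close>

lemma euclidean_killing_skew:
  fixes f :: "'a::real_inner \<Rightarrow> 'a"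
  assumes "\<And>x y. (f y - f x) \<bullet> (y - x) = 0"
  shows "(f x - f 0) \<bullet> y = - ((f y - f 0) \<bullet> x)"
  using assms[of x 0] assms[of y 0] assms[of y x]
  by (simp add: inner_diff_left inner_diff_right algebra_simps)

text \<open>Skewness moves the scalar to the other slot of the inner product, where it factors out,
  and a second use of skewness moves the vector back.\<close>

lemma euclidean_killing_linear:
  fixes f :: "'a::real_inner \<Rightarrow> 'a"
  assumes "\<And>x y. (f y - f x) \<bullet> (y - x) = 0"
  shows "f (a *\<^sub>R x) - f 0 = a *\<^sub>R (f x - f 0)"
proof (rule vector_eq_ldot[THEN iffD1], rule allI)
  fix r
  note s = euclidean_killing_skew[of f, OF assms]
  have "(f (a *\<^sub>R x) - f 0) \<bullet> r = - ((f r - f 0) \<bullet> (a *\<^sub>R x))" by (rule s)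
  also have "\<dots> = a * - ((f r - f 0) \<bullet> x)" by simp
  also have "- ((f r - f 0) \<bullet> x) = (f x - f 0) \<bullet> r" by (simp add: s[of x r])
  finally show "r \<bullet> (f (a *\<^sub>R x) - f 0) = r \<bullet> (a *\<^sub>R (f x - f 0))"
    by (simp add: inner_commute)
qed

text \<open>The second component is a projective vector field on the affine chart. The first is its
  cotangent lift, the covector v -> -p . (Db(x) v), shifted by the constant \<open>d\<close>; the
  same \<open>d\<close> governs the quadratic part of b.\<close>

definition proj_field :: "real^'n^'n \<Rightarrow> real^'n \<Rightarrow> real^'n \<Rightarrow> 'n::finite phase vector_field" where
  "proj_field L d c = (\<lambda>z.
     (d - fst z v* L - (1 / 2 * (snd z \<bullet> fst z)) *\<^sub>R d - (1 / 2 * (d \<bullet> snd z)) *\<^sub>R fst z,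
      c + L *v snd z + (1 / 2 * (d \<bullet> snd z)) *\<^sub>R snd z))"

lemma bounded_linear_vector_matrix_mult: "bounded_linear (\<lambda>x. x v* (A :: real^'n^'m))"
proof -
  have "(\<lambda>x. x v* A) = (*v) (transpose A)" by (simp add: fun_eq_iff)
  then show ?thesis by (simp only: matrix_vector_mul_bounded_linear)
qed

lemma smooth_proj_field: "smooth (proj_field L d c)"
  unfolding proj_field_def
  by (intro smooth_intros smooth_bounded_linear_comp[OF bounded_linear_vector_matrix_mult])

lemma has_derivative_proj_field:
  "(proj_field L d c has_derivative (\<lambda>v.
     (- (fst v v* L) - (1 / 2 * (snd z \<bullet> fst v + snd v \<bullet> fst z)) *\<^sub>R d
        - (1 / 2 * (d \<bullet> snd z)) *\<^sub>R fst v - (1 / 2 * (d \<bullet> snd v)) *\<^sub>R fst z,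
      L *v snd v + (1 / 2 * (d \<bullet> snd z)) *\<^sub>R snd v + (1 / 2 * (d \<bullet> snd v)) *\<^sub>R snd z))) (at z)"
  unfolding proj_field_def
  by (auto intro!: derivative_eq_intros
      bounded_linear.has_derivative[OF matrix_vector_mul_bounded_linear]
      bounded_linear.has_derivative[OF bounded_linear_vector_matrix_mult] simp: fun_eq_iff algebra_simps add_divide_distrib)

lemma proj_field_killing:
  fixes L :: "real^'n^'n"
  shows "proj_field L d c \<in> iso_G"
proof -
  have s: "v \<bullet> (p v* L) = p \<bullet> (L *v v)" for v p :: "real^'n" and L :: "real^'n^'n"
    by (metis dot_lmul_matrix inner_commute)
  have "lie_derivative (proj_field L d c) metric_G Y Z z = 0" if "smooth Y" "smooth Z" for Y Z z
    unfolding lie_derivative_metric_G[OF has_derivative_proj_field that] metric_G_inner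
    by (simp add: proj_field_def inner_simps dot_lmul_matrix s)
      (simp add: inner_commute algebra_simps add_divide_distrib diff_divide_distrib)
  then show ?thesis
    by (simp add: iso_G_def killing_fields_def smooth_proj_field)
qed

lemma frechet_derivative_proj_field:
  "frechet_derivative (proj_field L d c) (at z) = (\<lambda>v.
     (- (fst v v* L) - (1 / 2 * (snd z \<bullet> fst v + snd v \<bullet> fst z)) *\<^sub>R d
        - (1 / 2 * (d \<bullet> snd z)) *\<^sub>R fst v - (1 / 2 * (d \<bullet> snd v)) *\<^sub>R fst z,
      L *v snd v + (1 / 2 * (d \<bullet> snd z)) *\<^sub>R snd v + (1 / 2 * (d \<bullet> snd v)) *\<^sub>R snd z))"
  by (rule frechet_derivative_at[OF has_derivative_proj_field, symmetric])

definition outer :: "real^'n \<Rightarrow> real^'n \<Rightarrow> real^'n^'n" where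
  "outer u v = (\<chi> i j. u $ i * v $ j)"

lemma outer_mult_vec: "outer u v *v x = (v \<bullet> x) *\<^sub>R u"
  by (simp add: outer_def matrix_vector_mult_def inner_vec_def vec_eq_iff sum_distrib_left mult_ac)

text \<open>The quadratic part (d' . x) x / 2 has derivative (d' . x) c / 2 + (d' . c) x / 2 in the
  direction \<open>c\<close>, which is where the outer products and the multiple of
  \<open>mat 1\<close> arise. Two quadratic parts commute, so no terms of higher degree appear and
  the family is closed.\<close>

lemma lie_bracket_proj_field:
  "lie_bracket (proj_field L d c) (proj_field L' d' c') =
     proj_field (L' ** L - L ** L' + (1 / 2) *\<^sub>R (outer c d' - outer c' d)
        + (1 / 2 * (d' \<bullet> c - d \<bullet> c')) *\<^sub>R mat 1)
       (d' v* L - d v* L') (L' *v c - L *v c')"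
proof -
  have L: "v \<bullet> (p v* L) = p \<bullet> (L *v v)" for v p and L :: "real^'n^'n"
    by (metis dot_lmul_matrix inner_commute)
  note m = matrix_vector_mult_diff_rdistrib matrix_vector_mult_add_rdistrib
        matrix_vector_right_distrib matrix_vector_mult_diff_distrib
        scaleR_matrix_vector_assoc[symmetric] outer_mult_vec matrix_vector_mul_assoc[symmetric]
        matrix_vector_mult_scaleR
  show ?thesis
    unfolding lie_bracket_def frechet_derivative_proj_field
    by (rule ext, rule prod_eqI; rule vector_eq_ldot[THEN iffD1], rule allI)
      (simp add: proj_field_def m inner_simps L dot_lmul_matrix,
       simp add: inner_commute algebra_simps add_divide_distrib diff_divide_distrib)+
qed

lemma killing_imp_proj_field:
  fixes X :: "'n::finite phase vector_field"
  assumes "X \<in> iso_G"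
  obtains L d c where "X = proj_field L d c"
proof -
  define F where "F z = frechet_derivative X (at z)" for z
  define a where "a z = fst (X z)" for z
  define b where "b z = snd (X z)" for z
  define A where "A z v = fst (F z v)" for z v
  define B where "B z v = snd (F z v)" for z v
  have "smooth X" using assms by (simp add: iso_G_def killing_fields_def)
  then have D: "(X has_derivative F z) (at z)" for z
    unfolding F_def by (rule smooth_has_derivative)
  have Da: "(a has_derivative A z) (at z)" and Db: "(b has_derivative B z) (at z)" for z
    unfolding a_def[abs_def] b_def[abs_def] A_def[abs_def] B_def[abs_def]
    by (intro has_derivative_fst has_derivative_snd D)+
  \<comment> \<open>Constant test fields give the pointwise Killing equation.\<close>
  have K: "(a z \<bullet> snd v) * (fst z \<bullet> snd w) + (fst z \<bullet> snd v) * (a z \<bullet> snd w)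
      + metric_G z (F z v) w + metric_G z v (F z w) = 0" for z v w
  proof -
    have "lie_derivative X metric_G (\<lambda>z. v) (\<lambda>z. w) z = 0"
      using assms smooth_const unfolding iso_G_def killing_fields_def by blast
    then show ?thesis
      by (simp add: lie_derivative_metric_G[OF D smooth_const smooth_const] a_def)
  qed
  \<comment> \<open>The dp dp, mixed and dx dx blocks of the equation. The two symmetric blocks are
    recorded on the diagonal, which determines them by polarisation.\<close>
  have K1: "B z (\<alpha>, 0) \<bullet> \<alpha> = 0" for z \<alpha>
    using K[of z "(\<alpha>, 0)" "(\<alpha>, 0)"] by (simp add: metric_G_inner B_def inner_commute)
  have K2: "A z (\<alpha>, 0) \<bullet> \<xi> + (fst z \<bullet> B z (\<alpha>, 0)) * (fst z \<bullet> \<xi>) + \<alpha> \<bullet> B z (0, \<xi>) = 0" for z \<alpha> \<xi>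
    using K[of z "(\<alpha>, 0)" "(0, \<xi>)"] by (simp add: metric_G_inner A_def B_def)
  have K3: "(a z \<bullet> \<xi>) * (fst z \<bullet> \<xi>) + A z (0, \<xi>) \<bullet> \<xi> + (fst z \<bullet> B z (0, \<xi>)) * (fst z \<bullet> \<xi>) = 0" for z \<xi>
    using K[of z "(0, \<xi>)" "(0, \<xi>)"] by (simp add: metric_G_inner A_def B_def inner_commute algebra_simps)

  define c where "c x = b (0, x)" for x
  define h where "h x = a (0, x)" for x
  define C where "C x v = B (0, x) (0, v)" for x v
  have b_killing: "(b (p, x) - b (q, x)) \<bullet> (p - q) = 0" for p q x
  proof (rule euclidean_killing[where f' = "\<lambda>p v. B (p, x) (v, 0)"])
    show "((\<lambda>p. b (p, x)) has_derivative (\<lambda>v. B (p, x) (v, 0))) (at p)" for p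
      by (rule has_derivative_compose[OF _ Db, of "\<lambda>p. (p, x)"]) (auto intro!: derivative_eq_intros)
  qed (rule K1)
  define \<beta> where "\<beta> p x = b (p, x) - c x" for p x
  have \<beta>_skew: "\<beta> p x \<bullet> q = - (\<beta> q x \<bullet> p)" for p q x
    unfolding \<beta>_def c_def by (rule euclidean_killing_skew[of "\<lambda>p. b (p, x)", OF b_killing])
  \<comment> \<open>Skewness of \<beta> moves the varying point into the slot where the inner
    product is linear, so b is affine in t along the line and its p-derivative does not depend on
    p.\<close>
  have B_p: "B (p, x) (\<alpha>, 0) = \<beta> \<alpha> x" for p x \<alpha>
  proof (rule vector_eq_rdot[THEN iffD1], rule allI)
    fix w
    show "B (p, x) (\<alpha>, 0) \<bullet> w = \<beta> \<alpha> x \<bullet> w"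
    proof (rule derivative_along_line_unique[OF Db])
      show "b ((p, x) + t *\<^sub>R (\<alpha>, 0)) \<bullet> w = c x \<bullet> w - \<beta> w x \<bullet> p - t * (\<beta> w x \<bullet> \<alpha>)" for t
        using \<beta>_skew[of "p + t *\<^sub>R \<alpha>" x w] by (simp add: \<beta>_def[of "p + t *\<^sub>R \<alpha>"] inner_simps)
      show "((\<lambda>t. c x \<bullet> w - \<beta> w x \<bullet> p - t * (\<beta> w x \<bullet> \<alpha>)) has_real_derivative \<beta> \<alpha> x \<bullet> w) (at 0)"
        by (auto intro!: derivative_eq_intros simp: \<beta>_skew[of w])
    qed
  qed
  have B_x: "B (t *\<^sub>R p, x) (0, \<xi>) \<bullet> p = C x \<xi> \<bullet> p" for t p x \<xi>
  proof -
    \<comment> \<open>The component of b along p is constant on the ray through p, for every y;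
      hence so is its derivative in the x directions. At t = 0 there is no factor t to cancel, so
      that case is separate.\<close>
    have "b (t *\<^sub>R p, y) \<bullet> p = b (0, y) \<bullet> p" for y
      using b_killing[of "t *\<^sub>R p" y 0] by (cases "t = 0") (auto simp: inner_diff_left)
    then have "b ((t *\<^sub>R p, x) + s *\<^sub>R (0, \<xi>)) \<bullet> p = b ((0, x) + s *\<^sub>R (0, \<xi>)) \<bullet> p" for s
      by simp
    then show ?thesis
      unfolding C_def
      by (rule derivative_along_line_unique[OF Db]) (rule has_real_derivative_along_line, simp add: Db)
  qed
  have a_eq: "a (p, x) \<bullet> \<xi> = h x \<bullet> \<xi> - p \<bullet> C x \<xi>" for p x \<xi>
  proof -
    have "((\<lambda>t. a ((0, x) + t *\<^sub>R (p, 0)) \<bullet> \<xi> + t * (p \<bullet> C x \<xi>)) has_real_derivative 0) (at t)" for t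
    proof -
      \<comment> \<open>At the base point t p in the direction p, the term of \<open>K2\<close>
        quadratic in p vanishes because \<open>\<beta> p x\<close> is orthogonal to p, and
        \<open>B_x\<close> replaces the last term by its value at p = 0. The derivative along the
        ray is therefore constant.\<close>
      have "A ((0, x) + t *\<^sub>R (p, 0)) (p, 0) \<bullet> \<xi> + p \<bullet> C x \<xi> = 0"
        using K2[of "(t *\<^sub>R p, x)" p \<xi>] \<beta>_skew[of p x p]
        by (simp add: B_p inner_commute[of p] B_x)
      then show ?thesis
        by (intro DERIV_cong[OF DERIV_add[OF has_real_derivative_along_line[OF Da]
              DERIV_cmult_right[OF DERIV_ident]]]) simp
    qed
    from DERIV_isconst_all[OF allI[OF this], of 1 0] show ?thesis
      by (simp add: h_def)
  qed
  have A_p: "A (p, x) (\<alpha>, 0) \<bullet> \<xi> = - (\<alpha> \<bullet> C x \<xi>)" for p x \<alpha> \<xi>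
    by (rule derivative_along_line_unique[OF Da, where g = "\<lambda>t. h x \<bullet> \<xi> - p \<bullet> C x \<xi> - t * (\<alpha> \<bullet> C x \<xi>)"])
      (auto intro!: derivative_eq_intros simp: a_eq inner_simps)
  \<comment> \<open>Since \<open>\<beta> (- p) x = - \<beta> p x\<close>, adding the mixed Killing equation at \<open>p\<close> and \<open>- p\<close>
    leaves only the term quadratic in \<open>p\<close>.\<close>
  have \<beta>_zero: "\<beta> \<alpha> x = 0" for \<alpha> x
  proof -
    have odd: "b (p, y) + b (- p, y) = 2 *\<^sub>R c y" for p y
      using euclidean_killing_linear[of "\<lambda>p. b (p, y)" "-1" p, OF b_killing]
      by (simp add: c_def scaleR_2 algebra_simps)
    have sum: "B (p, x) (0, \<xi>) \<bullet> \<alpha> + B (- p, x) (0, \<xi>) \<bullet> \<alpha> = 2 * (C x \<xi> \<bullet> \<alpha>)" for p \<xi>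
    proof -
      have "B (p, x) (0, \<xi>) \<bullet> \<alpha> = 2 * (C x \<xi> \<bullet> \<alpha>) - B (- p, x) (0, \<xi>) \<bullet> \<alpha>"
      proof (rule derivative_along_line_unique[OF Db])
        show "b ((p, x) + t *\<^sub>R (0, \<xi>)) \<bullet> \<alpha>
          = 2 * (b ((0, x) + t *\<^sub>R (0, \<xi>)) \<bullet> \<alpha>) - b ((- p, x) + t *\<^sub>R (0, \<xi>)) \<bullet> \<alpha>" for t
          using arg_cong[OF odd[of p "x + t *\<^sub>R \<xi>"], of "\<lambda>u. u \<bullet> \<alpha>"]
          by (simp add: c_def inner_add_left)
        show "((\<lambda>t. 2 * (b ((0, x) + t *\<^sub>R (0, \<xi>)) \<bullet> \<alpha>) - b ((- p, x) + t *\<^sub>R (0, \<xi>)) \<bullet> \<alpha>)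
          has_real_derivative 2 * (C x \<xi> \<bullet> \<alpha>) - B (- p, x) (0, \<xi>) \<bullet> \<alpha>) (at 0)"
          unfolding C_def
          by (intro DERIV_diff DERIV_cmult has_real_derivative_along_line) (simp_all add: Db)
      qed
      then show ?thesis by simp
    qed
    have "p \<bullet> \<beta> \<alpha> x = 0" for p
    proof -
      \<comment> \<open>The choice \<xi> = p turns the remaining factor into p . p, which is nonzero
        unless p = 0, where the claim is trivial.\<close>
      have "(p \<bullet> \<beta> \<alpha> x) * (p \<bullet> p) = 0"
        using K2[of "(p, x)" \<alpha> p] K2[of "(- p, x)" \<alpha> p] sum[of p p]
        by (simp only: A_p B_p fst_conv inner_commute[of \<alpha>] inner_minus_left minus_mult_minus)
      then show ?thesis by auto
    qed
    then show ?thesis using inner_eq_zero_iff by blast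
  qed
  then have b_eq: "b (p, x) = c x" for p x
    by (simp add: \<beta>_def)
  have Dc: "(c has_derivative C x) (at x)" for x
    unfolding c_def[abs_def] C_def[abs_def]
    by (rule has_derivative_compose[OF _ Db, of "\<lambda>x. (0, x)"]) (auto intro!: derivative_eq_intros)
  have B_x': "B (p, x) (0, \<xi>) = C x \<xi>" for p x \<xi>
  proof -
    have "((\<lambda>x. b (p, x)) has_derivative (\<lambda>v. B (p, x) (0, v))) (at x)"
      by (rule has_derivative_compose[OF _ Db, of "\<lambda>x. (p, x)"]) (auto intro!: derivative_eq_intros)
    then have "(\<lambda>v. B (p, x) (0, v)) = C x"
      using Dc[of x] by (simp add: b_eq has_derivative_unique)
    then show ?thesis by (rule fun_cong)
  qed
  \<comment> \<open>After substituting \<open>a_eq\<close>, the two terms of \<open>K3\<close>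
    containing C cancel.\<close>
  have A_x: "A (p, x) (0, \<xi>) \<bullet> \<xi> = - ((h x \<bullet> \<xi>) * (p \<bullet> \<xi>))" for p x \<xi>
    using K3[of "(p, x)" \<xi>] by (simp add: a_eq B_x' algebra_simps)

  have h_killing: "(h y - h x) \<bullet> (y - x) = 0" for x y
  proof (rule euclidean_killing[where f' = "\<lambda>x v. A (0, x) (0, v)"])
    show "(h has_derivative (\<lambda>v. A (0, x) (0, v))) (at x)" for x
      unfolding h_def[abs_def]
      by (rule has_derivative_compose[OF _ Da, of "\<lambda>x. (0, x)"]) (auto intro!: derivative_eq_intros)
  qed (simp add: A_x)
  have h_line: "h (x + t *\<^sub>R \<xi>) \<bullet> \<xi> = h x \<bullet> \<xi>" for x t \<xi>
    using h_killing[of "x + t *\<^sub>R \<xi>" x] by (cases "t = 0") (auto simp: inner_diff_left)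
  \<comment> \<open>By \<open>a_eq\<close> the function C is expressed through a and h, and
    \<open>A_x\<close> gives the derivative of a. This yields second-order information on c without
    differentiating c twice.\<close>
  have C_line: "C (x + t *\<^sub>R \<xi>) \<xi> \<bullet> p = C x \<xi> \<bullet> p + t * ((h x \<bullet> \<xi>) * (p \<bullet> \<xi>))" for x t \<xi> p
  proof -
    have "((\<lambda>t. a ((p, x) + t *\<^sub>R (0, \<xi>)) \<bullet> \<xi> + t * ((h x \<bullet> \<xi>) * (p \<bullet> \<xi>))) has_real_derivative 0) (at t)" for t
      by (intro DERIV_cong[OF DERIV_add[OF has_real_derivative_along_line[OF Da]
            DERIV_cmult_right[OF DERIV_ident]]]) (simp add: A_x h_line)
    from DERIV_isconst_all[OF allI[OF this], of t 0] show ?thesis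
      by (simp add: a_eq h_line inner_commute[of _ p])
  qed
  \<comment> \<open>\<open>C_line\<close> makes the derivative of c along a line affine in t, so one
    integration gives an exact second-order expansion.\<close>
  have c_line: "c (x + \<xi>) = c x + C x \<xi> + (1 / 2 * (h x \<bullet> \<xi>)) *\<^sub>R \<xi>" for x \<xi>
  proof (rule vector_eq_rdot[THEN iffD1], rule allI)
    fix p
    have "((\<lambda>t. c (x + t *\<^sub>R \<xi>) \<bullet> p - (t * (C x \<xi> \<bullet> p) + t\<^sup>2 / 2 * ((h x \<bullet> \<xi>) * (p \<bullet> \<xi>))))
        has_real_derivative 0) (at t)" for t
    proof -
      have "((\<lambda>t. t * (C x \<xi> \<bullet> p) + t\<^sup>2 / 2 * ((h x \<bullet> \<xi>) * (p \<bullet> \<xi>)))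
          has_real_derivative C (x + t *\<^sub>R \<xi>) \<xi> \<bullet> p) (at t)"
        by (auto intro!: derivative_eq_intros simp: C_line)
      from DERIV_diff[OF has_real_derivative_along_line[of c "C (x + t *\<^sub>R \<xi>)" x t \<xi> p, OF Dc] this]
      show ?thesis by simp
    qed
    from DERIV_isconst_all[OF allI[OF this], of 1 0]
    show "c (x + \<xi>) \<bullet> p = (c x + C x \<xi> + (1 / 2 * (h x \<bullet> \<xi>)) *\<^sub>R \<xi>) \<bullet> p"
      by (simp add: inner_simps inner_commute)
  qed
  define L where "L = matrix (C 0)"
  have L: "C 0 v = L *v v" for v
    unfolding L_def using has_derivative_linear[OF Dc] by (simp add: matrix_works)
  have c_eq: "c x = c 0 + L *v x + (1 / 2 * (h 0 \<bullet> x)) *\<^sub>R x" for x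
    using c_line[of 0 x] by (simp add: L)
  have C_eq: "C x \<xi> = L *v \<xi> + (1 / 2 * (h 0 \<bullet> x)) *\<^sub>R \<xi> + (1 / 2 * (h 0 \<bullet> \<xi>)) *\<^sub>R x" for x \<xi>
  proof -
    have "((\<lambda>x. c 0 + L *v x + (1 / 2 * (h 0 \<bullet> x)) *\<^sub>R x) has_derivative
        (\<lambda>\<xi>. L *v \<xi> + (1 / 2 * (h 0 \<bullet> x)) *\<^sub>R \<xi> + (1 / 2 * (h 0 \<bullet> \<xi>)) *\<^sub>R x)) (at x)"
      by (auto intro!: derivative_eq_intros
          bounded_linear.has_derivative[OF matrix_vector_mul_bounded_linear])
    then have "C x = (\<lambda>\<xi>. L *v \<xi> + (1 / 2 * (h 0 \<bullet> x)) *\<^sub>R \<xi> + (1 / 2 * (h 0 \<bullet> \<xi>)) *\<^sub>R x)"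
      using Dc[of x] unfolding c_eq[abs_def, symmetric] by (simp add: has_derivative_unique)
    then show ?thesis by simp
  qed
  have h_const: "h x = h 0" for x
  proof (rule vector_eq_rdot[THEN iffD1], rule allI)
    fix \<xi>
    \<comment> \<open>The expansion of c(x + \<xi>) at x is compared with the one at 0. Everything
      but the term quadratic in \<xi> agrees by \<open>c_eq\<close> and \<open>C_eq\<close>.\<close>
    have "(1 / 2 * (h x \<bullet> \<xi>)) *\<^sub>R \<xi> = (1 / 2 * (h 0 \<bullet> \<xi>)) *\<^sub>R \<xi>"
      using c_line[of x \<xi>] unfolding c_eq[of x] c_eq[of "x + \<xi>"] C_eq
      by (auto simp: inner_simps matrix_vector_right_distrib algebra_simps add_divide_distrib)
    then show "h x \<bullet> \<xi> = h 0 \<bullet> \<xi>" by auto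
  qed
  have "X = proj_field L (h 0) (c 0)"
  proof (rule ext, rule prod_eqI)
    fix z :: "'n phase"
    obtain p x where z: "z = (p, x)" by (cases z)
    show "snd (X z) = snd (proj_field L (h 0) (c 0) z)"
      using b_eq[of p x] c_eq[of x] by (simp add: z b_def proj_field_def)
    have "fst (X z) \<bullet> \<xi> = fst (proj_field L (h 0) (c 0) z) \<bullet> \<xi>" for \<xi>
      using a_eq[of p x \<xi>]
      by (simp add: a_def C_eq h_const[of x] z proj_field_def inner_simps dot_lmul_matrix)
        (simp add: inner_commute)
    then show "fst (X z) = fst (proj_field L (h 0) (c 0) z)"
      by (rule vector_eq_rdot[THEN iffD1, OF allI])
  qed
  then show thesis by (rule that)
qed

section \<open>Projective matrices\<close>

lemma real_lie_algebra_image: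
  fixes \<phi> :: "'b::ab_group_add \<Rightarrow> 'c::ab_group_add"
  assumes "real_lie_algebra sc br L" and "vector_space sc'"
    and add: "\<And>x y. x \<in> L \<Longrightarrow> y \<in> L \<Longrightarrow> \<phi> (x + y) = \<phi> x + \<phi> y"
    and scale: "\<And>c x. x \<in> L \<Longrightarrow> \<phi> (sc c x) = sc' c (\<phi> x)"
    and bracket: "\<And>x y. x \<in> L \<Longrightarrow> y \<in> L \<Longrightarrow> \<phi> (br x y) = br' (\<phi> x) (\<phi> y)"
  shows "real_lie_algebra sc' br' (\<phi> ` L)"
proof -
  interpret L: real_lie_algebra sc br L by fact
  interpret V: vector_space sc' by fact
  have closed: "0 \<in> L" "\<And>x y. x \<in> L \<Longrightarrow> y \<in> L \<Longrightarrow> x + y \<in> L" "\<And>c x. x \<in> L \<Longrightarrow> sc c x \<in> L"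
    using L.subspace_carrier by (auto simp: L.subspace_def)
  have zero: "\<phi> 0 = 0"
    using add[OF closed(1) closed(1)] by simp
  show ?thesis
  proof
    show "V.subspace (\<phi> ` L)"
      unfolding V.subspace_def using closed by (auto simp: zero[symmetric] add[symmetric] scale[symmetric])
  qed (auto simp: add[symmetric] scale[symmetric] bracket[symmetric] zero closed L.br_closed L.br_self
        L.br_add_left L.br_add_right L.br_scale_left L.br_scale_right L.jacobi)
qed

text \<open>The explicit maps below run from matrices to vector fields, whereas the theorem states
  the opposite direction. Closure of \<open>L\<close> puts sums, multiples and brackets in the
  domain on which the inverse undoes \<phi>.\<close>

lemma lie_isomorphic_sym:
  assumes "lie_isomorphic sc br L sc' br' L'" and "real_lie_algebra sc br L"
  shows "lie_isomorphic sc' br' L' sc br L"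
proof -
  interpret L: real_lie_algebra sc br L by fact
  have closed: "\<And>x y. x \<in> L \<Longrightarrow> y \<in> L \<Longrightarrow> x + y \<in> L" "\<And>c x. x \<in> L \<Longrightarrow> sc c x \<in> L"
    using L.subspace_carrier by (auto simp: L.subspace_def)
  obtain \<phi> where \<phi>: "bij_betw \<phi> L L'"
      "\<And>x y. x \<in> L \<Longrightarrow> y \<in> L \<Longrightarrow> \<phi> (x + y) = \<phi> x + \<phi> y"
      "\<And>c x. x \<in> L \<Longrightarrow> \<phi> (sc c x) = sc' c (\<phi> x)"
      "\<And>x y. x \<in> L \<Longrightarrow> y \<in> L \<Longrightarrow> \<phi> (br x y) = br' (\<phi> x) (\<phi> y)"
    using assms(1) unfolding lie_isomorphic_def by blast
  define \<psi> where "\<psi> = inv_into L \<phi>"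
  have inv: "\<psi> (\<phi> x) = x" if "x \<in> L" for x
    using \<phi>(1) that by (simp add: \<psi>_def bij_betw_def)
  have "bij_betw \<psi> L' L"
    unfolding \<psi>_def using \<phi>(1) by (rule bij_betw_inv_into)
  moreover have "L' = \<phi> ` L"
    using \<phi>(1) by (simp add: bij_betw_def)
  ultimately show ?thesis
    unfolding lie_isomorphic_def
    by (intro exI[of _ \<psi>]) (auto simp: inv closed L.br_closed \<phi>(2-4)[symmetric])
qed

lemma matrix_diff_ldistrib: "A ** (B - C) = A ** B - A ** (C :: real^'n^'m)"
  and matrix_add_rdistrib: "(B + C) ** A = B ** A + (C :: real^'n^'m) ** A"
  and matrix_diff_rdistrib: "(B - C) ** A = B ** A - (C :: real^'n^'m) ** A"
  by (simp_all add: matrix_eq matrix_vector_mul_assoc[symmetric] matrix_vector_mult_diff_rdistrib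
      matrix_vector_mult_diff_distrib matrix_vector_mult_add_rdistrib)

lemma matrix_scaleR_left: "(r *\<^sub>R A) ** B = r *\<^sub>R (A ** (B :: real^'n^'m))"
  and matrix_scaleR_right: "A ** (r *\<^sub>R B) = r *\<^sub>R (A ** (B :: real^'n^'m))"
  by (simp_all add: matrix_scalar_ac scalar_matrix_assoc)

lemma real_lie_algebra_commutator:
  assumes "subspace L" and "\<And>A B. A \<in> L \<Longrightarrow> B \<in> L \<Longrightarrow> commutator A B \<in> L"
  shows "real_lie_algebra scaleR commutator (L :: (real^'m^'m) set)"
proof -
  have "module.subspace scaleR L"
    using assms(1) by (simp add: subspace_raw_def)
  then show ?thesis
    by unfold_locales
      (auto simp: commutator_def assms(2)[unfolded commutator_def] matrix_add_ldistrib matrix_add_rdistrib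
        matrix_diff_ldistrib matrix_diff_rdistrib matrix_scaleR_left matrix_scaleR_right
        matrix_mul_assoc algebra_simps)
qed

lemma trace_scaleR: "trace (r *\<^sub>R A) = r * trace (A :: real^'m^'m)"
  by (simp add: trace_def sum_distrib_left)

lemma real_lie_algebra_sl: "real_lie_algebra scaleR commutator (sl :: (real^'m^'m) set)"
proof (rule real_lie_algebra_commutator)
  show "subspace (sl :: (real^'m^'m) set)"
    by (simp add: sl_def subspace_def trace_add trace_scaleR trace_0[unfolded mat_0])
  show "commutator A B \<in> sl" for A B :: "real^'m^'m"
    using trace_mul_sym[of A B] by (simp add: sl_def commutator_def trace_sub)
qed

lemma real_lie_algebra_gl: "real_lie_algebra scaleR commutator (gl :: (real^'m^'m) set)"
  by (rule real_lie_algebra_commutator) (auto simp: gl_def)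

lemma proj_field_add:
  "proj_field L d c + proj_field L' d' c' = proj_field (L + L') (d + d') (c + c')"
  by (simp add: proj_field_def fun_eq_iff algebra_simps add_divide_distrib)

lemma proj_field_scale:
  "vf_scale r (proj_field L d c) = proj_field (r *\<^sub>R L) (r *\<^sub>R d) (r *\<^sub>R c)"
  by (simp add: proj_field_def vf_scale_def fun_eq_iff scaleR_matrix_vector_assoc[symmetric]
      vector_scaleR_matrix_ac algebra_simps)

lemma proj_field_zero: "proj_field 0 0 0 = 0"
  using proj_field_scale[of 0 0 0 0] by (simp add: vf_scale_def fun_eq_iff)

lemma proj_field_inject:
  "proj_field L d c = proj_field L' d' c' \<longleftrightarrow> L = L' \<and> d = d' \<and> c = c'"
proof
  assume eq: "proj_field L d c = proj_field L' d' c'"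
  \<comment> \<open>The value at the origin is (d, c). Once these agree, the second component on p =
    0 leaves only the linear part.\<close>
  have "c = c'" "d = d'"
    using fun_cong[OF eq, of 0] by (simp_all add: proj_field_def)
  moreover have "L *v x = L' *v x" for x
    using fun_cong[OF eq, of "(0, x)"] by (simp add: proj_field_def calculation)
  ultimately show "L = L' \<and> d = d' \<and> c = c'"
    by (simp add: matrix_eq)
qed simp

section \<open>Matrices of size n + 2 and the vector fields they induce\<close>

lemma sum_UNIV_option:
  "(\<Sum>x\<in>UNIV. f x) = f None + (\<Sum>x\<in>UNIV. f (Some x))" for f :: "'a::finite option \<Rightarrow> 'b::comm_monoid_add"
  by (simp add: UNIV_option_conv sum.reindex)

text \<open>The index \<open>None\<close> is the additional homogeneous coordinate of projective
  space, so a matrix over \<open>'n option\<close> splits into this block, a row, a column and a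
  corner.\<close>

definition block :: "real^('n option)^('n option) \<Rightarrow> real^'n^'n" where
  "block M = (\<chi> i j. M $ Some i $ Some j)"

definition last_row :: "real^('n option)^('n option) \<Rightarrow> real^'n" where
  "last_row M = (\<chi> j. M $ None $ Some j)"

definition last_col :: "real^('n option)^('n option) \<Rightarrow> real^'n" where
  "last_col M = (\<chi> i. M $ Some i $ None)"

abbreviation corner :: "real^('n::finite option)^('n option) \<Rightarrow> real" where
  "corner M \<equiv> M $ None $ None"

text \<open>Over \<open>b\<close> this is minus the projective vector field induced by \<open>M\<close> in the affine chart, the sign
  making the map a homomorphism; scalar matrices act trivially.\<close>

definition matrix_field :: "real^('n option)^('n option) \<Rightarrow> 'n::finite phase vector_field" where
  "matrix_field M = proj_field (corner M *\<^sub>R mat 1 - block M) (2 *\<^sub>R last_row M) (- last_col M)"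

lemma block_mult:
  fixes M N :: "real^('n::finite option)^('n option)"
  shows "block (M ** N) = block M ** block N + outer (last_col M) (last_row N)"
    and "last_row (M ** N) = last_row M v* block N + corner M *\<^sub>R last_row N"
    and "last_col (M ** N) = block M *v last_col N + corner N *\<^sub>R last_col M"
    and "corner (M ** N) = last_row M \<bullet> last_col N + corner M * corner N"
  by (simp_all add: block_def last_row_def last_col_def matrix_matrix_mult_def vec_eq_iff sum_UNIV_option
      outer_def vector_matrix_mult_def matrix_vector_mult_def inner_vec_def mult.commute)

lemma block_linear:
  "block (M + N) = block M + block N" "block (M - N) = block M - block N" "block (r *\<^sub>R M) = r *\<^sub>R block M"
  "last_row (M + N) = last_row M + last_row N" "last_row (M - N) = last_row M - last_row N"
  "last_row (r *\<^sub>R M) = r *\<^sub>R last_row M"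
  "last_col (M + N) = last_col M + last_col N" "last_col (M - N) = last_col M - last_col N"
  "last_col (r *\<^sub>R M) = r *\<^sub>R last_col M"
  by (simp_all add: block_def last_row_def last_col_def vec_eq_iff)

lemma trace_option: "trace M = corner M + trace (block M)"
  by (simp add: trace_def sum_UNIV_option block_def)

lemma matrix_field_add: "matrix_field (M + N) = matrix_field M + matrix_field N"
  by (simp add: matrix_field_def proj_field_add block_linear algebra_simps)

lemma matrix_field_scale: "matrix_field (r *\<^sub>R M) = vf_scale r (matrix_field M)"
  by (simp add: matrix_field_def proj_field_scale block_linear algebra_simps)

text \<open>The scalar parts commute with everything and cancel. The factor 2 on the row absorbs the
  1/2 of the bracket formula; the outer products are those of block multiplication, and the
  \<open>mat 1\<close> term is the corner of the commutator.\<close>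

lemma matrix_field_commutator:
  "matrix_field (commutator M N) = lie_bracket (matrix_field M) (matrix_field N)"
proof -
  have 1: "corner (M ** N - N ** M) *\<^sub>R mat 1 - block (M ** N - N ** M) =
    (corner N *\<^sub>R mat 1 - block N) ** (corner M *\<^sub>R mat 1 - block M)
    - (corner M *\<^sub>R mat 1 - block M) ** (corner N *\<^sub>R mat 1 - block N)
    + (1 / 2) *\<^sub>R (outer (- last_col M) (2 *\<^sub>R last_row N) - outer (- last_col N) (2 *\<^sub>R last_row M))
    + (1 / 2 * ((2 *\<^sub>R last_row N) \<bullet> (- last_col M) - (2 *\<^sub>R last_row M) \<bullet> (- last_col N))) *\<^sub>R mat 1"
    by (simp add: block_linear block_mult matrix_eq matrix_vector_mult_diff_rdistrib
        matrix_vector_mult_add_rdistrib matrix_vector_mult_diff_distrib outer_mult_vec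
        scaleR_matrix_vector_assoc[symmetric] matrix_vector_mul_assoc[symmetric] matrix_vector_mult_scaleR)
      (simp add: algebra_simps inner_commute diff_divide_distrib)
  have 2: "2 *\<^sub>R last_row (M ** N - N ** M) =
      (2 *\<^sub>R last_row N) v* (corner M *\<^sub>R mat 1 - block M) - (2 *\<^sub>R last_row M) v* (corner N *\<^sub>R mat 1 - block N)"
    by (rule vector_eq_rdot[THEN iffD1]) (simp add: block_linear block_mult dot_lmul_matrix
        matrix_vector_mult_diff_rdistrib scaleR_matrix_vector_assoc[symmetric] inner_simps)
  have 3: "- last_col (M ** N - N ** M) =
      (corner N *\<^sub>R mat 1 - block N) *v (- last_col M) - (corner M *\<^sub>R mat 1 - block M) *v (- last_col N)"
    by (simp add: block_linear block_mult matrix_vector_mult_diff_rdistrib scaleR_matrix_vector_assoc[symmetric]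
        matrix_vector_mult_diff_distrib[where x = 0, simplified])
  show ?thesis
    unfolding matrix_field_def lie_bracket_proj_field commutator_def 1 2 3 ..
qed

lemma inj_on_matrix_field: "inj_on matrix_field (sl :: (real^('n::finite option)^('n option)) set)"
proof (rule inj_onI)
  fix M N :: "real^('n option)^('n option)"
  assume "M \<in> sl" "N \<in> sl" and eq: "matrix_field M = matrix_field N"
  then have tr: "trace (block M) = - corner M" "trace (block N) = - corner N"
    by (simp_all add: sl_def trace_option)
  have L: "corner M *\<^sub>R mat 1 - block M = corner N *\<^sub>R mat 1 - block N"
    and rc: "last_row M = last_row N" "last_col M = last_col N"
    using eq by (simp_all add: matrix_field_def proj_field_inject)
  \<comment> \<open>For trace-free \<open>M\<close> the matrix on the left has trace
    \<open>corner M * (CARD('n) + 1)\<close>, so the scalar ambiguity disappears.\<close>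
  from arg_cong[OF L, of trace] have "corner M * (CARD('n) + 1) = corner N * (CARD('n) + 1)"
    by (simp add: trace_sub trace_scaleR trace_I tr algebra_simps)
  then have corner: "corner M = corner N"
    by simp
  then have block: "block M = block N"
    using L by simp
  have "M $ i $ j = N $ i $ j" for i j
    using corner block rc by (cases i; cases j) (simp_all add: block_def last_row_def last_col_def vec_eq_iff)
  then show "M = N" by (simp add: vec_eq_iff)
qed

lemma matrix_field_surj: "\<exists>M\<in>sl. matrix_field M = proj_field L d c"
proof -
  \<comment> \<open>Solves e + (CARD('a) e - trace L) = 0, the condition that the matrix
    \<open>M\<close> below is trace-free.\<close>
  define e where "e = trace L / (CARD('a) + 1)"
  define M where "M = (\<chi> i j. case i of
      None \<Rightarrow> (case j of None \<Rightarrow> e | Some j \<Rightarrow> d $ j / 2)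
    | Some i \<Rightarrow> (case j of None \<Rightarrow> - c $ i | Some j \<Rightarrow> (e *\<^sub>R mat 1 - L) $ i $ j))"
  have M: "corner M = e" "block M = e *\<^sub>R mat 1 - L" "last_row M = (1 / 2) *\<^sub>R d" "last_col M = - c"
    by (simp_all add: M_def block_def last_row_def last_col_def vec_eq_iff)
  have "e * (CARD('a) + 1) = trace L"
    by (simp add: e_def)
  then have "M \<in> sl"
    by (simp add: sl_def trace_option M trace_sub trace_scaleR trace_I algebra_simps)
  moreover have "matrix_field M = proj_field L d c"
    by (simp add: matrix_field_def M)
  ultimately show ?thesis by blast
qed

lemma iso_G_eq: "(iso_G :: 'n::finite phase vector_field set) = {proj_field L d c | L d c. True}"
proof
  show "(iso_G :: 'n phase vector_field set) \<subseteq> {proj_field L d c | L d c. True}"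
  proof
    fix X :: "'n phase vector_field"
    assume "X \<in> iso_G"
    then obtain L d c where "X = proj_field L d c"
      by (rule killing_imp_proj_field)
    then show "X \<in> {proj_field L d c | L d c. True}" by auto
  qed
qed (auto simp: proj_field_killing)

lemma iso_G_eq_matrix_field: "iso_G = matrix_field ` sl"
proof -
  have "proj_field L d c \<in> matrix_field ` sl" for L :: "real^'a^'a" and d c
    using matrix_field_surj[of L d c] by (metis imageI)
  then show ?thesis
    by (auto simp: iso_G_eq matrix_field_def)
qed

text \<open>Closure under the bracket and the Jacobi identity are inherited from \<open>sl\<close>
  through \<open>matrix_field\<close>, instead of being checked by differentiating vector
  fields.\<close>

lemma real_lie_algebra_iso_G: "real_lie_algebra vf_scale lie_bracket iso_G"
  unfolding iso_G_eq_matrix_field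
  by (rule real_lie_algebra_image[OF real_lie_algebra_sl vf.vector_space_axioms])
    (simp_all add: matrix_field_add matrix_field_scale matrix_field_commutator)

lemma lie_isomorphic_iso_G_sl:
  "lie_isomorphic vf_scale lie_bracket (iso_G :: 'n::finite phase vector_field set)
     scaleR commutator (sl :: (real^('n option)^('n option)) set)"
proof -
  have "lie_isomorphic scaleR commutator (sl :: (real^('n option)^('n option)) set) vf_scale lie_bracket
      (iso_G :: 'n phase vector_field set)"
    unfolding lie_isomorphic_def
    by (intro exI[of _ matrix_field])
      (simp add: bij_betw_def inj_on_matrix_field iso_G_eq_matrix_field matrix_field_add
        matrix_field_scale matrix_field_commutator)
  then show ?thesis
    by (rule lie_isomorphic_sym[OF _ real_lie_algebra_sl])
qed

section \<open>The generators and the three subalgebras\<close>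

lemma sum_fun_apply: "(\<Sum>i\<in>A. f i) z = (\<Sum>i\<in>A. f i z)"
  by (induction A rule: infinite_finite_induct) auto

lemma matrix_unit_mult:
  "axis j (axis i 1) = (outer (axis j 1) (axis i 1) :: real^'n^'n)"
  by (simp add: outer_def axis_def vec_eq_iff)

lemma vec_matrix_outer: "v v* outer a b = (v \<bullet> a) *\<^sub>R b"
  by (rule vector_eq_rdot[THEN iffD1]) (simp add: dot_lmul_matrix outer_mult_vec mult.commute)

lemma outer_mult_outer: "outer a b ** outer c d = (b \<bullet> c) *\<^sub>R outer a d"
  by (simp add: matrix_eq matrix_vector_mul_assoc[symmetric] outer_mult_vec matrix_vector_mult_scaleR
      scaleR_matrix_vector_assoc[symmetric])

lemma outer_zero [simp]: "outer 0 v = 0" "outer v 0 = 0"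
  by (simp_all add: outer_def vec_eq_iff)

text \<open>The indices appear transposed: on the x coordinates the field is x -> x^i e_j, whose
  matrix has its only entry in row j, column i.\<close>

lemma Q_fld_eq: "Q_fld i j = proj_field (outer (axis j 1) (axis i 1)) 0 0"
  by (simp add: Q_fld_def proj_field_def pd_x_def pd_p_def fun_eq_iff outer_mult_vec vec_matrix_outer
      inner_axis inner_axis')

lemma X_fld_eq: "X_fld s = proj_field 0 0 (axis s 1)"
  by (simp add: X_fld_def proj_field_def pd_x_def fun_eq_iff)

lemma Q_tot_apply: "Q_tot z = (- fst z, snd z)"
  by (simp add: Q_tot_def sum_fun_apply Q_fld_def pd_x_def pd_p_def prod_eq_iff fst_sum snd_sum
      vec_eq_iff axis_def if_distrib sum.delta cong: if_cong)

lemma Q_tot_eq: "Q_tot = proj_field (mat 1) 0 0"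
  by (simp add: fun_eq_iff Q_tot_apply proj_field_def)

lemma sum_coord_eq_inner: "(\<Sum>l\<in>UNIV. x_coord l z * p_coord l z) = snd z \<bullet> fst z"
  by (simp add: inner_vec_def)

text \<open>For d = e_i the multiple of \<open>Q_tot\<close> supplies (d . x) x / 2 and -(d . x) p /
  2, and the \<open>pd_p\<close> term supplies the two remaining terms.\<close>

lemma D_fld_eq: "D_fld i = proj_field 0 (axis i 1) 0"
  unfolding D_fld_def sum_coord_eq_inner
  by (simp add: proj_field_def pd_p_def fun_eq_iff Q_tot_apply inner_axis' algebra_simps)

text \<open>Identifies the spans defining the three subalgebras with the fields in which only one of
  the parameters \<open>L\<close>, \<open>d\<close>, \<open>c\<close> may be nonzero.\<close>

lemma vf_span_image:
  fixes f :: "'v::real_vector \<Rightarrow> 'a \<Rightarrow> 'b::real_vector"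
  assumes "\<And>x y. f (x + y) = f x + f y" and "\<And>r x. f (r *\<^sub>R x) = vf_scale r (f x)"
    and "span B = UNIV"
  shows "vf.span (f ` B) = range f"
proof -
  interpret f: Vector_Spaces.linear scaleR vf_scale f
    by unfold_locales (simp_all add: assms scaleR_add_right scaleR_add_left)
  show ?thesis
    using f.span_image[of B] assms(3) by (simp add: span_raw_def)
qed

lemma Basis_vec_real: "(Basis :: (real^'n) set) = range (\<lambda>i. axis i 1)"
  by (auto simp: Basis_vec_def)

lemma Basis_matrix: "(Basis :: (real^'n^'n) set) = {axis j (axis i 1) | i j. True}"
  by (auto simp: Basis_vec_def)

lemma \<qq>_eq: "(\<qq> :: 'n::finite phase vector_field set) = range (\<lambda>L. proj_field L 0 0)"
proof -
  have "{Q_fld i j | (i :: 'n) j. True} = (\<lambda>L. proj_field L 0 0) ` Basis"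
    by (auto simp: Basis_matrix Q_fld_eq matrix_unit_mult)
  moreover have "vf.span ((\<lambda>L :: real^'n^'n. proj_field L 0 0) ` Basis) = range (\<lambda>L. proj_field L 0 0)"
    by (rule vf_span_image) (simp_all add: proj_field_add proj_field_scale)
  ultimately show ?thesis
    by (simp only: \<qq>_def)
qed

lemma \<dd>_eq: "(\<dd> :: 'n::finite phase vector_field set) = range (\<lambda>d. proj_field 0 d 0)"
proof -
  have "{D_fld i | i :: 'n. True} = (\<lambda>d. proj_field 0 d 0) ` Basis"
    by (auto simp: Basis_vec_real D_fld_eq)
  moreover have "vf.span ((\<lambda>d :: real^'n. proj_field 0 d 0) ` Basis) = range (\<lambda>d. proj_field 0 d 0)"
    by (rule vf_span_image) (simp_all add: proj_field_add proj_field_scale)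
  ultimately show ?thesis
    by (simp only: \<dd>_def)
qed

lemma \<xx>_eq: "(\<xx> :: 'n::finite phase vector_field set) = range (\<lambda>c. proj_field 0 0 c)"
proof -
  have "{X_fld s | s :: 'n. True} = (\<lambda>c. proj_field 0 0 c) ` Basis"
    by (auto simp: Basis_vec_real X_fld_eq)
  moreover have "vf.span ((\<lambda>c :: real^'n. proj_field 0 0 c) ` Basis) = range (\<lambda>c. proj_field 0 0 c)"
    by (rule vf_span_image) (simp_all add: proj_field_add proj_field_scale)
  ultimately show ?thesis
    by (simp only: \<xx>_def)
qed

lemma lie_subalgebra_\<qq>: "lie_subalgebra vf_scale lie_bracket \<qq> iso_G"
  unfolding lie_subalgebra_def
proof (intro conjI)
  show "vf.subspace \<qq>" by (simp add: \<qq>_def)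
qed (auto simp: \<qq>_eq proj_field_killing lie_bracket_proj_field proj_field_inject)

text \<open>Apart from the products of \<open>L\<close> and \<open>L'\<close>, every term of the
  bracket formula pairs two different kinds of parameter, so fields with only \<open>d\<close>
  commute; the same holds for \<open>c\<close>.\<close>

lemma lie_abelian_\<dd>: "lie_abelian lie_bracket \<dd>"
  by (auto simp: lie_abelian_def \<dd>_eq lie_bracket_proj_field proj_field_zero)

lemma lie_abelian_\<xx>: "lie_abelian lie_bracket \<xx>"
  by (auto simp: lie_abelian_def \<xx>_eq lie_bracket_proj_field proj_field_zero)

lemma lie_subalgebra_abelian:
  "vf.subspace M \<Longrightarrow> M \<subseteq> L \<Longrightarrow> lie_abelian lie_bracket M \<Longrightarrow> lie_subalgebra vf_scale lie_bracket M L"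
  by (simp add: lie_subalgebra_def lie_abelian_def vf.subspace_0)

lemma lie_subalgebra_\<dd>: "lie_subalgebra vf_scale lie_bracket \<dd> iso_G"
proof (rule lie_subalgebra_abelian[OF _ _ lie_abelian_\<dd>])
  show "vf.subspace \<dd>" by (simp add: \<dd>_def)
qed (auto simp: \<dd>_eq proj_field_killing)

lemma lie_subalgebra_\<xx>: "lie_subalgebra vf_scale lie_bracket \<xx> iso_G"
proof (rule lie_subalgebra_abelian[OF _ _ lie_abelian_\<xx>])
  show "vf.subspace \<xx>" by (simp add: \<xx>_def)
qed (auto simp: \<xx>_eq proj_field_killing)

text \<open>Existence and uniqueness of the decomposition are those of the parameters (L, d, c) of a
  Killing field.\<close>

lemma direct_sum3_iso_G: "direct_sum3 iso_G \<qq> \<dd> \<xx>"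
  unfolding direct_sum3_def bij_betw_def
proof
  show "inj_on (\<lambda>(a, b, c). a + b + c) (\<qq> \<times> \<dd> \<times> \<xx>)"
    by (auto simp: inj_on_def \<qq>_eq \<dd>_eq \<xx>_eq proj_field_add proj_field_inject)
  have "proj_field L d c \<in> (\<lambda>(a, b, c). a + b + c) ` (\<qq> \<times> \<dd> \<times> \<xx>)" for L d c
    by (rule image_eqI[of _ _ "(proj_field L 0 0, proj_field 0 d 0, proj_field 0 0 c)"])
      (auto simp: \<qq>_eq \<dd>_eq \<xx>_eq proj_field_add)
  then have "iso_G \<subseteq> (\<lambda>(a, b, c). a + b + c) ` (\<qq> \<times> \<dd> \<times> \<xx>)"
    unfolding iso_G_eq by blast
  moreover have "(\<lambda>(a, b, c). a + b + c) ` (\<qq> \<times> \<dd> \<times> \<xx>) \<subseteq> iso_G"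
    by (auto simp: \<qq>_eq \<dd>_eq \<xx>_eq proj_field_add proj_field_killing)
  ultimately show "(\<lambda>(a, b, c). a + b + c) ` (\<qq> \<times> \<dd> \<times> \<xx>) = iso_G"
    by blast
qed

text \<open>The bracket of linear fields is L' L - L L', the opposite of the commutator; the sign in
  \<open>proj_field (- L) 0 0\<close> corrects this.\<close>

lemma lie_isomorphic_\<qq>_gl:
  "lie_isomorphic vf_scale lie_bracket (\<qq> :: 'n::finite phase vector_field set)
     scaleR commutator (gl :: (real^'n^'n) set)"
proof -
  have "range (\<lambda>L. proj_field (- L) 0 0) = (\<qq> :: 'n phase vector_field set)"
    using image_image[of "\<lambda>L. proj_field L 0 0" uminus "UNIV :: (real^'n^'n) set"]
    by (simp add: \<qq>_eq surj_uminus)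
  then have "bij_betw (\<lambda>L. proj_field (- L) 0 0) gl (\<qq> :: 'n phase vector_field set)"
    by (simp add: bij_betw_def inj_on_def gl_def proj_field_inject)
  moreover have "- L ** - L' = L ** L'" for L L' :: "real^'n^'n"
    using matrix_scaleR_left[of "-1" L "- L'"] matrix_scaleR_right[of L "-1" L'] by simp
  ultimately have "lie_isomorphic scaleR commutator (gl :: (real^'n^'n) set) vf_scale lie_bracket
      (\<qq> :: 'n phase vector_field set)"
    unfolding lie_isomorphic_def
    by (intro exI[of _ "\<lambda>L. proj_field (- L) 0 0"])
      (simp add: proj_field_add proj_field_scale lie_bracket_proj_field commutator_def proj_field_inject)
  then show ?thesis
    by (rule lie_isomorphic_sym[OF _ real_lie_algebra_gl])
qed

section \<open>Hyperbolic rotations and Hamiltonian functions\<close>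

lemma generates_flow_Q_tot: "generates_flow Q_tot (\<lambda>t (p, x). (exp (- t) *\<^sub>R p, exp t *\<^sub>R x))"
  by (auto simp: generates_flow_def Q_tot_apply intro!: derivative_eq_intros has_vector_derivative_Pair)

lemma omega_inner: "omega z v w = fst v \<bullet> snd w - fst w \<bullet> snd v"
  by (simp add: omega_def inner_vec_def sum_subtractf)

lemma hamiltonian_functionI:
  assumes "smooth H" and "\<And>z. (H has_derivative \<Omega> z (X z)) (at z)"
  shows "hamiltonian_function \<Omega> X H"
  unfolding hamiltonian_function_def
  using assms(1) frechet_derivative_at[OF assms(2)] by simp

lemma has_derivative_coord:
  "((\<lambda>z. fst z $ i) has_derivative (\<lambda>v. fst v $ i)) (at z)"
  "((\<lambda>z. snd z $ i) has_derivative (\<lambda>v. snd v $ i)) (at z)"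
  by (rule bounded_linear_imp_has_derivative, rule bounded_linear_compose[OF bounded_linear_vec_nth],
      simp add: bounded_linear_fst bounded_linear_snd)+

lemma hamiltonian_Q_fld: "hamiltonian_function omega (Q_fld i j) (\<lambda>z. - (x_coord i z * p_coord j z))"
proof (rule hamiltonian_functionI)
  show "((\<lambda>z. - (x_coord i z * p_coord j z)) has_derivative omega z (Q_fld i j z)) (at z)" for z
    by (auto intro!: derivative_eq_intros has_derivative_coord
        simp: fun_eq_iff omega_inner Q_fld_def pd_x_def pd_p_def inner_axis inner_axis')
qed (intro smooth_intros)

lemma hamiltonian_X_fld: "hamiltonian_function omega (X_fld k) (\<lambda>z. - p_coord k z)"
proof (rule hamiltonian_functionI)
  show "((\<lambda>z. - p_coord k z) has_derivative omega z (X_fld k z)) (at z)" for z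
    by (auto intro!: derivative_eq_intros has_derivative_coord
        simp: fun_eq_iff omega_inner X_fld_def pd_x_def inner_axis inner_axis')
qed (intro smooth_intros)

lemma hamiltonian_D_fld:
  "hamiltonian_function omega (D_fld s)
     (\<lambda>z. x_coord s z * (1 - 1 / 2 * (\<Sum>l\<in>UNIV. x_coord l z * p_coord l z)))"
  unfolding sum_coord_eq_inner
proof (rule hamiltonian_functionI)
  show "((\<lambda>z. x_coord s z * (1 - 1 / 2 * (snd z \<bullet> fst z))) has_derivative omega z (D_fld s z)) (at z)" for z
    by (auto intro!: derivative_eq_intros has_derivative_coord
        simp: fun_eq_iff omega_inner D_fld_eq proj_field_def inner_simps inner_axis inner_axis'
          inner_commute algebra_simps)
qed (intro smooth_intros)

lemma inner_axis_kron: "axis i 1 \<bullet> (axis j 1 :: real^'n) = kron i j"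
  by (simp add: inner_axis_axis kron_def)

theorem theorem3:
  fixes n :: nat
  assumes "n \<ge> 1" and "CARD('n::finite) = n + 1"
  shows "
    real_lie_algebra vf_scale lie_bracket (iso_G :: 'n phase vector_field set) \<and>
    lie_isomorphic vf_scale lie_bracket (iso_G :: 'n phase vector_field set)
      scaleR commutator (sl :: (real^('n option)^('n option)) set) \<and>
    lie_subalgebra vf_scale lie_bracket (\<qq> :: 'n phase vector_field set) iso_G \<and>
    lie_subalgebra vf_scale lie_bracket (\<dd> :: 'n phase vector_field set) iso_G \<and>
    lie_subalgebra vf_scale lie_bracket (\<xx> :: 'n phase vector_field set) iso_G \<and>
    direct_sum3 (iso_G :: 'n phase vector_field set) \<qq> \<dd> \<xx> \<and>
    (\<forall>(i::'n) j r k. lie_bracket (Q_fld i j) (Q_fld r k) =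
       vf_scale (kron r j) (Q_fld i k) - vf_scale (kron i k) (Q_fld r j)) \<and>
    lie_isomorphic vf_scale lie_bracket (\<qq> :: 'n phase vector_field set)
      scaleR commutator (gl :: (real^'n^'n) set) \<and>
    lie_abelian lie_bracket (\<dd> :: 'n phase vector_field set) \<and>
    (Q_tot :: 'n phase vector_field) =
      (\<lambda>z. \<Sum>i\<in>UNIV. x_coord i z *\<^sub>R pd_x i z - p_coord i z *\<^sub>R pd_p i z) \<and>
    generates_flow (Q_tot :: 'n phase vector_field)
      (\<lambda>t (p, x). (exp (- t) *\<^sub>R p, exp t *\<^sub>R x)) \<and>
    lie_abelian lie_bracket (\<xx> :: 'n phase vector_field set) \<and>
    (\<forall>(i::'n) j s. lie_bracket (Q_fld i j) (X_fld s) = - vf_scale (kron i s) (X_fld j)) \<and>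
    (\<forall>(i::'n) j s. lie_bracket (Q_fld i j) (D_fld s) = vf_scale (kron s j) (D_fld i)) \<and>
    (\<forall>(i::'n) s. lie_bracket (X_fld s) (D_fld i) =
       vf_scale (1 / 2) (Q_fld i s) + vf_scale (1 / 2 * kron i s) Q_tot) \<and>
    (\<forall>(i::'n) j. hamiltonian_function omega (Q_fld i j) (\<lambda>z. - (x_coord i z * p_coord j z))) \<and>
    (\<forall>k::'n. hamiltonian_function omega (X_fld k) (\<lambda>z. - p_coord k z)) \<and>
    (\<forall>s::'n. hamiltonian_function omega (D_fld s)
       (\<lambda>z. x_coord s z * (1 - 1 / 2 * (\<Sum>l\<in>UNIV. x_coord l z * p_coord l z))))"
proof (intro conjI allI)
  show "lie_bracket (Q_fld i j) (Q_fld r k) = vf_scale (kron r j) (Q_fld i k) - vf_scale (kron i k) (Q_fld r j)"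
    for i j r k :: 'n
  proof -
    \<comment> \<open>The subtracted term is moved to the left, so that both sides are sums and
      multiples of \<open>proj_field\<close> and the parameters can be compared.\<close>
    have "lie_bracket (Q_fld i j) (Q_fld r k) + vf_scale (kron i k) (Q_fld r j) = vf_scale (kron r j) (Q_fld i k)"
      by (simp add: Q_fld_eq lie_bracket_proj_field outer_mult_outer proj_field_scale proj_field_add
          proj_field_inject inner_axis_kron)
    then show ?thesis by (simp add: eq_diff_eq)
  qed
  show "lie_bracket (Q_fld i j) (X_fld s) = - vf_scale (kron i s) (X_fld j)" for i j s :: 'n
  proof -
    have "lie_bracket (Q_fld i j) (X_fld s) + vf_scale (kron i s) (X_fld j) = 0"
      by (simp add: Q_fld_eq X_fld_eq lie_bracket_proj_field outer_mult_vec proj_field_scale proj_field_add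
          proj_field_zero inner_axis_kron)
    then show ?thesis by (simp add: eq_neg_iff_add_eq_0)
  qed
  show "lie_bracket (Q_fld i j) (D_fld s) = vf_scale (kron s j) (D_fld i)" for i j s :: 'n
    by (simp add: Q_fld_eq D_fld_eq lie_bracket_proj_field vec_matrix_outer proj_field_scale
        proj_field_inject inner_axis_kron)
  show "lie_bracket (X_fld s) (D_fld i) = vf_scale (1 / 2) (Q_fld i s) + vf_scale (1 / 2 * kron i s) Q_tot"
    for i s :: 'n
    by (simp add: Q_fld_eq X_fld_eq D_fld_eq Q_tot_eq lie_bracket_proj_field proj_field_scale proj_field_add
        proj_field_inject inner_axis_kron)
  show "(Q_tot :: 'n phase vector_field) =
      (\<lambda>z. \<Sum>i\<in>UNIV. x_coord i z *\<^sub>R pd_x i z - p_coord i z *\<^sub>R pd_p i z)"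
    by (simp add: fun_eq_iff Q_tot_def sum_fun_apply Q_fld_def)
qed (simp_all only: real_lie_algebra_iso_G lie_isomorphic_iso_G_sl lie_subalgebra_\<qq> lie_subalgebra_\<dd>
    lie_subalgebra_\<xx> direct_sum3_iso_G lie_isomorphic_\<qq>_gl lie_abelian_\<dd> lie_abelian_\<xx>
    generates_flow_Q_tot hamiltonian_Q_fld hamiltonian_X_fld hamiltonian_D_fld)

end
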